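(* Fix an orthant index $r$ (i.e. a sign matrix $J^{(r)}=\mathrm{diag}(j^{(r)}_{11},\dots,j^{(r)}_{nn})$, $j^{(r)}_{ii}\in\{-1,1\}$), and let $(X(t))_{t\ge 0}$ in $\mathbb R^n$ satisfy $X(t+1)=A^{(r)}X(t)+b^{(r)}(X(t))$ for all $t=0,1,2,\dots$. Let $\bar X_-=[\bar X_l]_{l\in\mathcal N^{(r)}}$ be given real upper bounds and assume $X_l(t)\le\bar X_l$ for all $l\in\mathcal N^{(r)}$ and all $t\ge 0$. If $$(Dp)_i\ \ge\ \big((\hat C^{-1}-C\hat C^{-1})\underline v\big)_i-\hat c_{ii}^{-1}\big(A^{(r)}_-\bar X_-\big)_i\qquad\text{for all } i\in\mathcal P^{(r)},$$ then $$X_i(0)\ge 0\ \text{ for all } i\in\mathcal P^{(r)}\ \Longrightarrow\ X_i(t)\ge 0\ \text{ for all } i\in\mathcal P^{(r)}\text{ and all } t=0,1,2,\dots.$$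
   Context: Setting: $N=\{1,\dots,n\}$; $C=[c_{il}]\in\mathbb R^{n\times n}$ with $c_{il}\in[0,1]$, $c_{ii}=0$; $\hat c_{ii}:=1-\sum_{j\ne i}c_{ji}$, assumed $>0$ for every $i$; $\hat C:=\mathrm{diag}(\hat c_{11},\dots,\hat c_{nn})$; $D\in\mathbb R^{n\times m}$, $p\in\mathbb R^m$, $\underline v\in\mathbb R^n$ are given; $\beta\ge 0$ is a real number; $\mathbf 1$ is the all-ones vector; $I$ is the identity matrix. For a sign matrix $J^{(r)}$: $\mathcal P^{(r)}:=\{i: j^{(r)}_{ii}=1\}$, $\mathcal N^{(r)}:=\{i: j^{(r)}_{ii}=-1\}$. Failure term: $U(x)=[U_i(x)]_i$ with $U_i(x)=\beta/2$ if $x_i<0$ and $U_i(x)=-\beta/2$ if $x_i\ge 0$. $A^{(r)}=[a^{(r)}_{ij}]:=J^{(r)}\hat C C\hat C^{-1}J^{(r)}$, and $A^{(r)}_-:=[a^{(r)}_{ij}]_{i\in\mathcal P^{(r)},\,j\in\mathcal N^{(r)}}$ is the submatrix with rows in $\mathcal P^{(r)}$ and columns in $\mathcal N^{(r)}$, so $(A^{(r)}_-\bar X_-)_i=\sum_{l\in\mathcal N^{(r)}}a^{(r)}_{il}\bar X_l$ for $i\in\mathcal P^{(r)}$. For $X\in\mathbb R^n$, $$b^{(r)}(X):=J^{(r)}\Big[(\hat C C\hat C^{-1}-I)\underline v+\hat C\big(Dp-U(J^{(r)}X)-\mathbf 1\tfrac{\beta}{2}\big)\Big].$$ *)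

theory Defs
  imports "HOL-Analysis.Analysis"
begin

definition diag_matrix :: "real ^ 'n \<Rightarrow> real ^ 'n ^ 'n" where
  "diag_matrix d = (\<chi> i k. if i = k then d $ i else 0)"

text \<open>Column sums: \<open>chat C i\<close> subtracts the entries \<open>C $ j $ i\<close>, not \<open>C $ i $ j\<close>.\<close>

definition chat :: "real ^ 'n ^ 'n \<Rightarrow> 'n \<Rightarrow> real" where
  "chat C i = 1 - (\<Sum>j\<in>UNIV - {i}. C $ j $ i)"

definition Chat :: "real ^ 'n ^ 'n \<Rightarrow> real ^ 'n ^ 'n" where
  "Chat C = diag_matrix (\<chi> i. chat C i)"

definition sign_matrix :: "real ^ 'n ^ 'n \<Rightarrow> bool" where
  "sign_matrix J \<longleftrightarrow> (\<exists>s. (\<forall>i. s $ i \<in> {-1, 1}) \<and> J = diag_matrix s)"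

definition pos_idx :: "real ^ 'n ^ 'n \<Rightarrow> 'n set" where
  "pos_idx J = {i. J $ i $ i = 1}"

definition neg_idx :: "real ^ 'n ^ 'n \<Rightarrow> 'n set" where
  "neg_idx J = {i. J $ i $ i = -1}"

definition failure_term :: "real \<Rightarrow> real ^ 'n \<Rightarrow> real ^ 'n" where
  "failure_term \<beta> x = (\<chi> i. if x $ i < 0 then \<beta> / 2 else - \<beta> / 2)"

definition A_mat :: "real ^ 'n ^ 'n \<Rightarrow> real ^ 'n ^ 'n \<Rightarrow> real ^ 'n ^ 'n" where
  "A_mat C J = J ** Chat C ** C ** matrix_inv (Chat C) ** J"

text \<open>The vector \<open>1 :: real ^ 'n\<close> has all components equal to one; the identity matrix is \<open>mat 1\<close>.\<close>

definition b_vec ::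
  "real ^ 'n ^ 'n \<Rightarrow> real ^ 'm ^ 'n \<Rightarrow> real ^ 'm \<Rightarrow> real ^ 'n \<Rightarrow> real \<Rightarrow> real ^ 'n ^ 'n \<Rightarrow> real ^ 'n \<Rightarrow> real ^ 'n"
  where
  "b_vec C D p v \<beta> J X =
     J *v ((Chat C ** C ** matrix_inv (Chat C) - mat 1) *v v
           + Chat C *v (D *v p - failure_term \<beta> (J *v X) - (\<beta> / 2) *\<^sub>R 1))"

text \<open>
  Component \<open>i\<close> of the product of the submatrix of \<open>A_mat C J\<close> with rows in \<open>pos_idx J\<close> and
  columns in \<open>neg_idx J\<close> by a vector indexed by \<open>neg_idx J\<close>. Since the index sets depend on \<open>J\<close>,
  they cannot be types: the function is meant for \<open>i \<in> pos_idx J\<close> only, and the vector is a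
  function on all indices, of which only the values on \<open>neg_idx J\<close> are used.
\<close>

definition A_minus_mult :: "real ^ 'n ^ 'n \<Rightarrow> real ^ 'n ^ 'n \<Rightarrow> ('n \<Rightarrow> real) \<Rightarrow> 'n \<Rightarrow> real" where
  "A_minus_mult C J Y i = (\<Sum>l\<in>neg_idx J. A_mat C J $ i $ l * Y l)"

end

theory Submission
  imports Defs
begin

text \<open>
  Fix \<open>i\<close> in the positive index set. The entries of \<open>A\<close> in row \<open>i\<close> are nonnegative in the columns
  of the positive set and nonpositive in the columns of the negative set, so the upper bounds on the
  negative coordinates give a lower bound on \<open>A X(t)\<close>. As long as \<open>X\<^sub>i(t) \<ge> 0\<close> the failure
  term cancels the constant \<open>\<beta> / 2\<close>, and the condition, scaled by the \<open>i\<close>-th entry of \<open>Chat C\<close>,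
  says exactly that this lower bound plus the remaining part of \<open>b\<close> is nonnegative.
\<close>

lemma diag_matrix_mult_nth: "(diag_matrix d ** M) $ i $ k = d $ i * M $ i $ k"
  by (simp add: matrix_matrix_mult_def diag_matrix_def if_distrib[of "\<lambda>x. x * _"] cong: if_cong)

lemma mult_diag_matrix_nth: "(M ** diag_matrix d) $ i $ k = M $ i $ k * d $ k"
  by (simp add: matrix_matrix_mult_def diag_matrix_def if_distrib cong: if_cong)

lemma diag_matrix_mult_vec_nth: "(diag_matrix d *v x) $ i = d $ i * x $ i"
  by (simp add: matrix_vector_mult_def diag_matrix_def if_distrib[of "\<lambda>x. x * _"] cong: if_cong)

text \<open>\<open>matrix_inv\<close> is a choice operator, so it is identified by uniqueness: a
  right inverse of a square matrix is two-sided, and two inverses agree by associativity.\<close>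

lemma matrix_inv_diag_matrix:
  assumes "\<And>i. d $ i \<noteq> 0"
  shows "matrix_inv (diag_matrix d) = diag_matrix (\<chi> i. inverse (d $ i))"
proof -
  let ?E = "diag_matrix (\<chi> i. inverse (d $ i))"
  have right: "diag_matrix d ** ?E = mat 1"
    using assms by (simp add: vec_eq_iff diag_matrix_mult_nth) (simp add: diag_matrix_def mat_def)
  then have left: "?E ** diag_matrix d = mat 1"
    by (simp add: matrix_left_right_inverse)
  \<comment> \<open>The entrywise inverse witnesses existence, so the chosen matrix really is an
    inverse.\<close>
  from right left have "diag_matrix d ** matrix_inv (diag_matrix d) = mat 1
      \<and> matrix_inv (diag_matrix d) ** diag_matrix d = mat 1"
    unfolding matrix_inv_def by (intro someI[where P = "\<lambda>B. diag_matrix d ** B = mat 1 \<and> B ** diag_matrix d = mat 1"]) blast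
  then have "matrix_inv (diag_matrix d) ** (diag_matrix d ** ?E) = ?E"
    by (simp add: matrix_mul_assoc)
  with right show ?thesis
    by simp
qed

text \<open>All factors except \<open>C\<close> are diagonal and only rescale its rows and
  columns.\<close>

lemma A_mat_nth:
  assumes "\<And>i. chat C i \<noteq> 0" and "sign_matrix J"
  shows "A_mat C J $ i $ l = J $ i $ i * chat C i * C $ i $ l * inverse (chat C l) * J $ l $ l"
proof -
  obtain s where "J = diag_matrix s"
    using assms(2) unfolding sign_matrix_def by blast
  then show ?thesis
    using assms(1)
    \<comment> \<open>Regrouping \<open>J ** Chat C ** C\<close> to the right leaves a single
      diagonal matrix as the outer factor of each product.\<close>
    by (simp add: A_mat_def Chat_def matrix_mul_assoc[of _ _ C, symmetric] matrix_inv_diag_matrix mult_diag_matrix_nth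
        diag_matrix_mult_nth)
      (simp add: diag_matrix_def)
qed

lemma sign_matrix_idx_cases:
  assumes "sign_matrix J"
  shows "pos_idx J \<union> neg_idx J = UNIV" and "pos_idx J \<inter> neg_idx J = {}"
  using assms by (auto simp: sign_matrix_def pos_idx_def neg_idx_def diag_matrix_def)

lemma A_mat_mult_vec_ge:
  assumes C_nonneg: "\<And>i l. 0 \<le> C $ i $ l"
    and chat_pos: "\<And>i. 0 < chat C i"
    and J: "sign_matrix J"
    and i: "i \<in> pos_idx J"
    and pos: "\<And>l. l \<in> pos_idx J \<Longrightarrow> 0 \<le> x $ l"
    and neg: "\<And>l. l \<in> neg_idx J \<Longrightarrow> x $ l \<le> Y l"
  shows "A_minus_mult C J Y i \<le> (A_mat C J *v x) $ i"
proof -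
  have entry: "A_mat C J $ i $ l = chat C i * C $ i $ l * inverse (chat C l) * J $ l $ l" for l
    using i A_mat_nth[OF less_imp_neq[OF chat_pos, symmetric] J] by (simp add: pos_idx_def)
  have weight: "0 \<le> chat C i * C $ i $ l * inverse (chat C l)" for l
    using C_nonneg chat_pos by (simp add: less_imp_le)
  have "0 \<le> A_mat C J $ i $ l * x $ l" if "l \<in> pos_idx J" for l
    using weight[of l] pos[OF that] that by (simp add: entry pos_idx_def)
  then have P: "0 \<le> (\<Sum>l\<in>pos_idx J. A_mat C J $ i $ l * x $ l)"
    by (rule sum_nonneg)
  \<comment> \<open>Here \<open>J $ l $ l = -1\<close> reverses the bound
    \<open>x $ l \<le> Y l\<close>.\<close>
  have "A_mat C J $ i $ l * Y l \<le> A_mat C J $ i $ l * x $ l" if "l \<in> neg_idx J" for l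
    using mult_left_mono[OF neg[OF that] weight[of l]] that by (simp add: entry neg_idx_def)
  then have N: "A_minus_mult C J Y i \<le> (\<Sum>l\<in>neg_idx J. A_mat C J $ i $ l * x $ l)"
    unfolding A_minus_mult_def by (rule sum_mono)
  have "(A_mat C J *v x) $ i = (\<Sum>l\<in>pos_idx J \<union> neg_idx J. A_mat C J $ i $ l * x $ l)"
    by (simp add: matrix_vector_mult_def sign_matrix_idx_cases(1)[OF J])
  also have "\<dots> = (\<Sum>l\<in>pos_idx J. A_mat C J $ i $ l * x $ l)
      + (\<Sum>l\<in>neg_idx J. A_mat C J $ i $ l * x $ l)"
    by (rule sum.union_disjoint) (simp_all add: sign_matrix_idx_cases(2)[OF J])
  finally show ?thesis
    using P N by simp
qed

text \<open>Since \<open>J\<close> acts as 1 on coordinate \<open>i\<close>, the failure term sees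
  \<open>x $ i\<close> itself and equals \<open>- \<beta> / 2\<close>. Writing \<open>v\<close> as
  \<open>Chat C\<close> times its inverse applied to \<open>v\<close> lets \<open>chat C i\<close>
  factor out.\<close>

lemma b_vec_nth_pos_idx:
  assumes chat: "\<And>i. chat C i \<noteq> 0"
    and J: "sign_matrix J"
    and i: "i \<in> pos_idx J"
    and x: "0 \<le> x $ i"
  shows "b_vec C D p v \<beta> J x $ i
    = chat C i * ((D *v p) $ i - ((matrix_inv (Chat C) - C ** matrix_inv (Chat C)) *v v) $ i)"
proof -
  obtain s where s: "J = diag_matrix s"
    using J unfolding sign_matrix_def by blast
  have si: "s $ i = 1"
    using i by (simp add: s pos_idx_def diag_matrix_def)
  have inv: "(matrix_inv (Chat C) *v v) $ i = inverse (chat C i) * v $ i"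
    using chat by (simp add: Chat_def matrix_inv_diag_matrix diag_matrix_mult_vec_nth)
  have assoc: "(Chat C ** C ** matrix_inv (Chat C)) *v v
      = Chat C *v ((C ** matrix_inv (Chat C)) *v v)"
    by (simp add: matrix_vector_mul_assoc matrix_mul_assoc)
  have Chat: "(Chat C *v y) $ i = chat C i * y $ i" for y
    by (simp add: Chat_def diag_matrix_mult_vec_nth)
  show ?thesis
    unfolding b_vec_def s matrix_vector_mult_diff_rdistrib assoc
    using chat[of i] si x
    by (simp add: diag_matrix_mult_vec_nth Chat inv failure_term_def field_simps)
qed

theorem theorem3:
  fixes C J :: "real ^ 'n ^ 'n"
    and D :: "real ^ 'm ^ 'n"
    and p :: "real ^ 'm"
    and v :: "real ^ 'n"
    and \<beta> :: real
    and X :: "nat \<Rightarrow> real ^ 'n"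
    and Xbar :: "'n \<Rightarrow> real"
  assumes C_range: "\<And>i l. C $ i $ l \<in> {0..1}"
    and C_diag: "\<And>i. C $ i $ i = 0"
    and chat_pos: "\<And>i. chat C i > 0"
    and \<beta>_nonneg: "\<beta> \<ge> 0"
    and J_sign: "sign_matrix J"
    and dynamics: "\<And>t. X (Suc t) = A_mat C J *v X t + b_vec C D p v \<beta> J (X t)"
    and upper_bound: "\<And>l t. l \<in> neg_idx J \<Longrightarrow> X t $ l \<le> Xbar l"
    and condition: "\<And>i. i \<in> pos_idx J \<Longrightarrow>
          (D *v p) $ i \<ge> ((matrix_inv (Chat C) - C ** matrix_inv (Chat C)) *v v) $ i
                          - inverse (chat C i) * A_minus_mult C J Xbar i"
  shows "(\<forall>i\<in>pos_idx J. X 0 $ i \<ge> 0) \<longrightarrow> (\<forall>i\<in>pos_idx J. \<forall>t. X t $ i \<ge> 0)"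
proof
  assume init: "\<forall>i\<in>pos_idx J. X 0 $ i \<ge> 0"
  have C_nonneg: "0 \<le> C $ i $ l" for i l
    using C_range[of i l] by simp
  \<comment> \<open>The induction treats all positive indices at once, because row \<open>i\<close>
    of the dynamics involves every positive coordinate.\<close>
  have "\<forall>i\<in>pos_idx J. 0 \<le> X t $ i" for t
  proof (induction t)
    case 0
    show ?case by (rule init)
  next
    case (Suc t)
    show ?case
    proof
      fix i assume i: "i \<in> pos_idx J"
      have b: "b_vec C D p v \<beta> J (X t) $ i
          = chat C i * ((D *v p) $ i - ((matrix_inv (Chat C) - C ** matrix_inv (Chat C)) *v v) $ i)"
        using b_vec_nth_pos_idx[OF less_imp_neq[OF chat_pos, symmetric] J_sign i] Suc i by blast
      have "- inverse (chat C i) * A_minus_mult C J Xbar i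
          \<le> (D *v p) $ i - ((matrix_inv (Chat C) - C ** matrix_inv (Chat C)) *v v) $ i"
        using condition[OF i] by simp
      \<comment> \<open>Scaling by \<open>chat C i\<close> clears the inverse on the left and
        produces the \<open>b_vec\<close> entry on the right.\<close>
      from mult_left_mono[OF this less_imp_le[OF chat_pos[of i]]]
      have "- A_minus_mult C J Xbar i \<le> b_vec C D p v \<beta> J (X t) $ i"
        using chat_pos[of i] by (simp add: b mult.assoc[symmetric])
      moreover have "A_minus_mult C J Xbar i \<le> (A_mat C J *v X t) $ i"
        using C_nonneg chat_pos J_sign i Suc upper_bound by (intro A_mat_mult_vec_ge) auto
      ultimately show "0 \<le> X (Suc t) $ i"
        by (simp add: dynamics)
    qed
  qed
  then show "\<forall>i\<in>pos_idx J. \<forall>t. X t $ i \<ge> 0"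
    by blast
qed

end
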